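(* Let $D$ be a weighted loopless digraph (without multiple arcs) with $n\geq 2$ vertices. If $d^{w+}(v)\geq 1$ for every vertex $v\in V(D)$, then $D$ contains a directed cycle $C$ such that $w(C)\geq \dfrac{1}{\log_2 n}$.
   Context: All digraphs are finite and contain no multiple arcs: for each ordered pair $(u,v)$ of vertices there is at most one arc $uv$ from $u$ to $v$ (both $uv$ and $vu$ may be present). A loop is an arc $vv$; a digraph is loopless if it has no loops. $V(D)$ and $A(D)$ denote the sets of vertices and arcs of $D$. A weighted digraph is a digraph $D$ in which each arc $a$ is assigned a nonnegative real number $w(a)$, its weight. For a vertex $v$, $N^+(v)$ is the set of vertices to which there is an arc from $v$, and the weighted outdegree of $v$ is $d^{w+}(v)=\sum_{u\in N^+(v)} w(vu)$. The weight of a subdigraph $H$ of $D$ is $w(H)=\sum_{a\in A(H)} w(a)$. A directed cycle is a subdigraph consisting of distinct vertices $v_1,\dots,v_k$ and the arcs $v_1v_2,\dots,v_{k-1}v_k,v_kv_1$; in a loopless digraph $k\geq 2$, and $k=2$ is allowed. *)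

theory Defs
  imports Complex_Main "Graph_Theory.Graph_Theory"
begin

definition out_neighbours :: "'a pair_pre_digraph \<Rightarrow> 'a \<Rightarrow> 'a set" where
  "out_neighbours D v = {u. (v, u) \<in> parcs D}"

definition weighted_outdegree :: "'a pair_pre_digraph \<Rightarrow> ('a \<times> 'a) weight_fun \<Rightarrow> 'a \<Rightarrow> real" where
  "weighted_outdegree D w v = (\<Sum>u\<in>out_neighbours D v. w (v, u))"

(* A cycle is given as the list of its arcs, in order. The weight of the corresponding
   subdigraph is the sum over its set of arcs; a cycle never repeats an arc. *)
definition cycle_weight :: "('a \<times> 'a) weight_fun \<Rightarrow> ('a \<times> 'a) awalk \<Rightarrow> real" where
  "cycle_weight w C = (\<Sum>a\<in>set C. w a)"

end

theory Submission
  imports Defs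
begin

text \<open>
  If all directed cycles have weight less than \<open>c\<close>, then the weighted outdegrees \<open>d(v)\<close> satisfy
  the Kraft-type inequality \<open>\<Sum>v. 2 powr (- d(v) / c) \<ge> 1\<close>, strictly if there are at least two
  vertices; taking \<open>c = 1 / log 2 n\<close>, the outdegrees cannot all be at least 1.

  The inequality is proved by induction on the number of vertices. Let \<open>s\<close> have maximum outdegree
  and let \<open>rs\<close> be a heaviest arc into \<open>s\<close> (if there is none, delete \<open>s\<close>). Drop the arcs out of
  \<open>r\<close>, merge \<open>r\<close> into \<open>s\<close>, and add up the weights of parallel arcs. A cycle through a merged arc
  \<open>xs\<close> lifts to one through \<open>xr\<close> and \<open>rs\<close> that is at least as heavy, because
  \<open>w(xs) + w(xr) \<le> w(rs) + w(xr)\<close>. Only \<open>s\<close> loses outdegree, namely \<open>w(sr) < c\<close>, so its summand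
  less than doubles, and the lost summand of \<open>r\<close> is at least that of \<open>s\<close> and makes up for it.
\<close>

section \<open>Cycles as cyclic vertex lists\<close>

definition cycle_arcs :: "'a list \<Rightarrow> ('a \<times> 'a) list" where
  "cycle_arcs xs = zip xs (rotate1 xs)"

text \<open>Rotations of a list represent the same cycle. A one-element list stands for a loop,
  which only looplessness of \<open>A\<close> excludes.\<close>

definition is_cycle :: "('a \<times> 'a) set \<Rightarrow> 'a list \<Rightarrow> bool" where
  "is_cycle A xs \<longleftrightarrow> xs \<noteq> [] \<and> distinct xs \<and> set (cycle_arcs xs) \<subseteq> A"

lemma cycle_arcs_rotate: "cycle_arcs (rotate k xs) = rotate k (cycle_arcs xs)"
proof -
  have zip_rotate1: "zip (rotate1 xs) (rotate1 ys) = rotate1 (zip xs ys)"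
    if "length xs = length ys" for xs ys :: "'a list"
    using that by (cases xs; cases ys) auto
  show ?thesis
    by (induction k) (auto simp: cycle_arcs_def zip_rotate1)
qed

lemma fst_set_cycle_arcs: "fst ` set (cycle_arcs xs) = set xs"
  unfolding cycle_arcs_def by (metis length_rotate1 list.set_map map_fst_zip)

text \<open>For \<open>z = x\<close> the left side is \<open>cycle_arcs (x # ys)\<close>, so this
  splits the closing arc off the path; \<open>z\<close> is independent of \<open>x\<close> for the
  sake of the induction.\<close>

lemma zip_shift: "zip (x # ys) (ys @ [z]) = zip (x # ys) ys @ [(last (x # ys), z)]"
  by (induction ys arbitrary: x) auto

lemma snd_in_set_zip: "a \<in> set (zip xs ys) \<Longrightarrow> snd a \<in> set ys"
  by (metis prod.collapse set_zip_rightD)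

lemma is_cycle_rotate_to:
  assumes "is_cycle A xs" "s \<in> set xs"
  obtains ys where "is_cycle A (s # ys)"
    "sum_list (map w (cycle_arcs (s # ys))) = (sum_list (map w (cycle_arcs xs)) :: real)"
proof -
  obtain us vs where xs: "xs = us @ s # vs"
    using assms(2) by (auto dest: split_list)
  have rot: "rotate (length us) xs = s # vs @ us"
    unfolding xs by (simp add: rotate_append)
  have rotate1: "sum_list (map w (rotate1 zs)) = sum_list (map w zs)" for zs
    by (cases zs) auto
  have sum: "sum_list (map w (rotate k zs)) = sum_list (map w zs)" for k zs
    by (induction k) (auto simp: rotate1)
  show thesis
  proof
    show "is_cycle A (s # vs @ us)"
      using assms(1) unfolding is_cycle_def rot[symmetric] cycle_arcs_rotate by simp
    show "sum_list (map w (cycle_arcs (s # vs @ us))) = sum_list (map w (cycle_arcs xs))"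
      unfolding rot[symmetric] cycle_arcs_rotate by (rule sum)
  qed
qed

section \<open>Lifting cycles through a contraction\<close>

text \<open>Only arcs into \<open>s\<close> are new or reweighted, and a cycle enters
  \<open>s\<close> at most once, say by \<open>(x, s)\<close>. If \<open>(x, r)\<close> is in
  \<open>A\<close>, the detour through \<open>r\<close> is at least as heavy; otherwise
  \<open>w (x, r) = 0\<close> and the cycle already lies in \<open>A\<close> with the same
  weight.\<close>

lemma lift_contracted_cycle:
  fixes w :: "'a \<times> 'a \<Rightarrow> real"
  assumes zero: "\<And>a. a \<notin> A \<Longrightarrow> w a = 0" and nonneg: "\<And>a. w a \<ge> 0"
    and rs: "(r, s) \<in> A" and heaviest: "\<And>x. w (x, s) \<le> w (r, s)"
    and A': "A' = {(x, y) \<in> A. x \<noteq> r \<and> y \<noteq> r} \<union> {(x, s) | x. (x, r) \<in> A \<and> x \<noteq> s \<and> x \<noteq> r}"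
    and w': "w' = (\<lambda>(x, y). if y = s \<and> x \<noteq> s then w (x, s) + w (x, r) else w (x, y))"
    and neq: "r \<noteq> s" and loopless: "(s, s) \<notin> A"
    and cycle: "is_cycle A' xs"
  obtains ys where "is_cycle A ys"
    "sum_list (map w' (cycle_arcs xs)) \<le> sum_list (map w (cycle_arcs ys))"
proof (cases "s \<in> set xs")
  case False
  have arcs: "snd a \<noteq> s" if "a \<in> set (cycle_arcs xs)" for a
    using snd_in_set_zip[of a xs "rotate1 xs"] that False unfolding cycle_arcs_def by auto
  have "map w' (cycle_arcs xs) = map w (cycle_arcs xs)"
    using arcs by (auto simp: w')
  moreover have "is_cycle A xs"
    using cycle arcs unfolding is_cycle_def A' by fastforce
  ultimately show thesis using that[of xs] by (metis order_refl)
next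
  case True
  then obtain ys where cyc: "is_cycle A' (s # ys)"
    and wt: "sum_list (map w' (cycle_arcs (s # ys))) = sum_list (map w' (cycle_arcs xs))"
    using is_cycle_rotate_to[OF cycle] by blast
  define x where "x = last (s # ys)"
  have arcs: "cycle_arcs (s # ys) = zip (s # ys) ys @ [(x, s)]"
    unfolding cycle_arcs_def x_def by (simp only: rotate1.simps zip_shift)
  have arcs_r: "cycle_arcs (r # s # ys) = (r, s) # zip (s # ys) ys @ [(x, r)]"
    unfolding cycle_arcs_def x_def by (simp only: rotate1.simps zip_shift append_Cons zip_Cons_Cons)
  have dist: "distinct (s # ys)" and sub: "set (zip (s # ys) ys) \<subseteq> A'" and xs: "(x, s) \<in> A'"
    using cyc unfolding is_cycle_def arcs by auto
  have inner: "snd a \<noteq> s" if "a \<in> set (zip (s # ys) ys)" for a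
    using snd_in_set_zip[OF that] dist by auto
  have subA: "set (zip (s # ys) ys) \<subseteq> A"
    using sub inner unfolding A' by fastforce
  have same: "map w' (zip (s # ys) ys) = map w (zip (s # ys) ys)"
    using inner by (auto simp: w')
  \<comment> \<open>Otherwise the closing arc would be a loop at \<open>s\<close>, where
    \<open>w'\<close> does not add the two weights.\<close>
  have "x \<noteq> s" using xs loopless neq unfolding A' by auto
  then have wt_eq: "sum_list (map w' (cycle_arcs xs))
      = sum_list (map w (zip (s # ys) ys)) + (w (x, s) + w (x, r))"
    unfolding wt[symmetric] arcs map_append sum_list_append same by (simp add: w')
  show thesis
  proof (cases "(x, r) \<in> A")
    case True
    \<comment> \<open>Every vertex of the cycle is the tail of one of its arcs, and no arc of
      \<open>A'\<close> has tail \<open>r\<close>; hence inserting \<open>r\<close> repeats no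
      vertex.\<close>
    have "x' \<noteq> r" if "x' \<in> set (s # ys)" for x'
    proof -
      have "x' \<in> fst ` set (cycle_arcs (s # ys))"
        using that by (simp only: fst_set_cycle_arcs)
      then show ?thesis using cyc unfolding is_cycle_def A' using neq by auto
    qed
    then have "is_cycle A (r # s # ys)"
      using dist rs True subA unfolding is_cycle_def arcs_r by auto
    moreover have "sum_list (map w' (cycle_arcs xs)) \<le> sum_list (map w (cycle_arcs (r # s # ys)))"
      unfolding wt_eq arcs_r using heaviest[of x] by simp
    ultimately show thesis by (rule that)
  next
    case False
    then have "(x, s) \<in> A" using xs unfolding A' by auto
    then have "is_cycle A (s # ys)" using dist subA unfolding is_cycle_def arcs by simp
    moreover have "sum_list (map w' (cycle_arcs xs)) \<le> sum_list (map w (cycle_arcs (s # ys)))"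
      unfolding wt_eq arcs using zero[OF False] by simp
    ultimately show thesis by (rule that)
  qed
qed

section \<open>The Kraft-type inequality\<close>

lemma powr_merge_less:
  fixes a b l c :: real
  assumes "0 < c" "l < c" "a \<le> b"
  shows "2 powr (- (b - l) / c) < 2 powr (- a / c) + 2 powr (- b / c)"
proof -
  have "- (b - l) / c < 1 + - b / c" using assms by (simp add: field_simps)
  then have "2 powr (- (b - l) / c) < 2 powr (1 + - b / c)" by simp
  also have "\<dots> = 2 powr (- b / c) + 2 powr (- b / c)"
    using powr_add[of 2 1 "- b / c"] by simp
  also have "\<dots> \<le> 2 powr (- a / c) + 2 powr (- b / c)"
    using assms by (simp add: divide_right_mono)
  finally show ?thesis .
qed

text \<open>A single vertex gives equality, hence the two conclusions. The induction feeds on the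
  weak one, and each step from a smaller vertex set regains strictness. Since \<open>w\<close>
  vanishes off \<open>A\<close>, outdegrees can be summed over all of \<open>V\<close>.\<close>

lemma kraft_inequality:
  fixes w :: "'a \<times> 'a \<Rightarrow> real"
  assumes "finite V" "V \<noteq> {}" "A \<subseteq> V \<times> V" "\<And>v. (v, v) \<notin> A"
    and "\<And>a. a \<notin> A \<Longrightarrow> w a = 0" "\<And>a. w a \<ge> 0" and c: "0 < c"
    and "\<And>xs. is_cycle A xs \<Longrightarrow> sum_list (map w (cycle_arcs xs)) < c"
  shows "1 \<le> (\<Sum>v\<in>V. 2 powr (- (\<Sum>u\<in>V. w (v, u)) / c)) \<and>
    (2 \<le> card V \<longrightarrow> 1 < (\<Sum>v\<in>V. 2 powr (- (\<Sum>u\<in>V. w (v, u)) / c)))"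
  using assms(1-6,8)
proof (induction "card V" arbitrary: V A w rule: less_induct)
  case less
  note fin = less.prems(1) and AV = less.prems(3) and loopless = less.prems(4)
    and zero = less.prems(5) and nonneg = less.prems(6) and cycles = less.prems(7)
  define d where "d v = (\<Sum>u\<in>V. w (v, u))" for v
  show ?case
  proof (cases "2 \<le> card V")
    case False
    then have "card V = 1"
      using less.prems(2) fin card_gt_0_iff[of V] by simp
    then obtain v where "V = {v}" by (auto simp: card_1_singleton_iff)
    then show ?thesis using zero[OF loopless] by simp
  next
    case True
    obtain s where s: "s \<in> V" and max: "\<And>v. v \<in> V \<Longrightarrow> d v \<le> d s"
      using obtains_MAX[OF fin less.prems(2), of d] fin by (metis Max_ge finite_imageI imageI)
    have "1 < (\<Sum>v\<in>V. 2 powr (- d v / c))"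
    proof (cases "\<exists>r. (r, s) \<in> A")
      case False
      \<comment> \<open>No arc enters \<open>s\<close>, so deleting \<open>s\<close> preserves all
        other outdegrees and removes a positive summand.\<close>
      define A' where "A' = {(x, y) \<in> A. x \<noteq> s}"
      define w' where "w' = (\<lambda>(x, y). if x = s then 0 else w (x, y))"
      have "is_cycle A xs \<and> sum_list (map w' (cycle_arcs xs)) \<le> sum_list (map w (cycle_arcs xs))"
        if "is_cycle A' xs" for xs
        using that nonneg unfolding is_cycle_def A'_def w'_def
        by (auto intro!: sum_list_mono)
      then have "sum_list (map w' (cycle_arcs xs)) < c" if "is_cycle A' xs" for xs
        using cycles that by fastforce
      moreover have "V - {s} \<noteq> {}" 
      proof
        assume "V - {s} = {}"
        then have "V = {s}" using s by auto
        then show False using True by simp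
      qed
      moreover have "card (V - {s}) < card V" using s fin by (rule card_Diff1_less[rotated])
      moreover have "A' \<subseteq> (V - {s}) \<times> (V - {s})"
        using AV False unfolding A'_def by auto
      moreover have "(v, v) \<notin> A'" for v using loopless unfolding A'_def by auto
      moreover have "w' a = 0" if "a \<notin> A'" for a
        using that zero[of a] unfolding A'_def w'_def by (cases a) auto
      moreover have "w' a \<ge> 0" for a using nonneg unfolding w'_def by (auto split: prod.split)
      ultimately have "1 \<le> (\<Sum>v\<in>V - {s}. 2 powr (- (\<Sum>u\<in>V - {s}. w' (v, u)) / c))"
        using less.hyps[of "V - {s}" A' w'] fin by blast
      also have "\<dots> = (\<Sum>v\<in>V - {s}. 2 powr (- d v / c))"
      proof (intro sum.cong refl)
        fix v assume "v \<in> V - {s}"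
        then have "d v = (\<Sum>u\<in>V - {s}. w' (v, u))"
          unfolding d_def w'_def using zero[of "(v, s)"] False s fin
          by (simp add: sum.remove)
        then show "2 powr (- (\<Sum>u\<in>V - {s}. w' (v, u)) / c) = 2 powr (- d v / c)" by simp
      qed
      also have "\<dots> < (\<Sum>v\<in>V. 2 powr (- d v / c))" using s fin by (simp add: sum.remove)
      finally show ?thesis .
    next
      case True
      define N where "N = {x. (x, s) \<in> A}"
      have N: "N \<subseteq> V" "N \<noteq> {}" using True AV unfolding N_def by auto
      then have finN: "finite N" using fin finite_subset by blast
      obtain r where "r \<in> N" and rmax: "\<And>x. x \<in> N \<Longrightarrow> w (x, s) \<le> w (r, s)"
        using obtains_MAX[OF finN N(2), of "\<lambda>x. w (x, s)"] finN
        by (metis (mono_tags, lifting) Max_ge finite_imageI imageI)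
      then have rs: "(r, s) \<in> A" and r: "r \<in> V" and neq: "r \<noteq> s"
        using N loopless unfolding N_def by auto
      have heaviest: "w (x, s) \<le> w (r, s)" for x
        using rmax[of x] zero[of "(x, s)"] nonneg[of "(r, s)"] unfolding N_def by fastforce
      define A' where "A' = {(x, y) \<in> A. x \<noteq> r \<and> y \<noteq> r} \<union> {(x, s) | x. (x, r) \<in> A \<and> x \<noteq> s \<and> x \<noteq> r}"
      define w1 where "w1 = (\<lambda>(x, y). if y = s \<and> x \<noteq> s then w (x, s) + w (x, r) else w (x, y))"
      \<comment> \<open>\<open>w1\<close> may be positive on arcs at \<open>r\<close>; the induction
        hypothesis wants weight 0 off \<open>A'\<close>.\<close>
      define w' where "w' = (\<lambda>a. if a \<in> A' then w1 a else 0)"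
      have w1_nonneg: "w1 a \<ge> 0" for a using nonneg unfolding w1_def by (auto split: prod.split)
      have "sum_list (map w' (cycle_arcs xs)) < c" if cyc: "is_cycle A' xs" for xs
      proof -
        have "map w' (cycle_arcs xs) = map w1 (cycle_arcs xs)"
          using cyc unfolding is_cycle_def w'_def by auto
        moreover obtain ys where "is_cycle A ys"
            "sum_list (map w1 (cycle_arcs xs)) \<le> sum_list (map w (cycle_arcs ys))"
          using lift_contracted_cycle[OF zero nonneg rs heaviest A'_def w1_def neq loopless cyc] by blast
        ultimately show ?thesis using cycles by (metis le_less_trans)
      qed
      moreover have "V - {r} \<noteq> {}" "card (V - {r}) < card V"
        using s neq card_Diff1_less[OF fin r] by auto
      moreover have "A' \<subseteq> (V - {r}) \<times> (V - {r})"
        using AV s neq unfolding A'_def by auto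
      moreover have "(v, v) \<notin> A'" for v using loopless unfolding A'_def by auto
      moreover have "w' a = 0" if "a \<notin> A'" for a using that unfolding w'_def by simp
      moreover have "w' a \<ge> 0" for a using w1_nonneg unfolding w'_def by simp
      ultimately have IH: "1 \<le> (\<Sum>v\<in>V - {r}. 2 powr (- (\<Sum>u\<in>V - {r}. w' (v, u)) / c))"
        using less.hyps[of "V - {r}" A' w'] fin by blast
      have w'_eq: "w' (v, u) = w1 (v, u)" if "v \<noteq> r" "u \<noteq> r" for u v
        using that zero[of "(v, u)"] zero[of "(v, r)"]
        unfolding w'_def w1_def A'_def by auto
      have sum_split: "(\<Sum>u\<in>V. f u) = f r + (f s + (\<Sum>u\<in>V - {r} - {s}. f u))"
        for f :: "'a \<Rightarrow> real"
        using s neq fin sum.remove[OF fin r, of f] sum.remove[of "V - {r}" s f] by simp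
      \<comment> \<open>For \<open>v\<close> other than \<open>s\<close> the weight of
        \<open>(v, r)\<close> moves to \<open>(v, s)\<close>; for \<open>s\<close> itself it would
        sit on a loop and is lost.\<close>
      have outdeg: "(\<Sum>u\<in>V - {r}. w' (v, u)) = (if v = s then d s - w (s, r) else d v)"
        if v: "v \<in> V - {r}" for v
      proof -
        have "(\<Sum>u\<in>V - {r}. w' (v, u)) = (\<Sum>u\<in>V - {r}. w1 (v, u))"
          using v by (intro sum.cong) (auto simp: w'_eq)
        also have "\<dots> = w1 (v, s) + (\<Sum>u\<in>V - {r} - {s}. w (v, u))"
          using s neq fin by (subst sum.remove[of _ s]) (auto simp: w1_def)
        finally have "(\<Sum>u\<in>V - {r}. w' (v, u)) = w1 (v, s) + (\<Sum>u\<in>V - {r} - {s}. w (v, u))" .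
        moreover have "d v = w (v, r) + (w (v, s) + (\<Sum>u\<in>V - {r} - {s}. w (v, u)))"
          unfolding d_def by (rule sum_split)
        ultimately show ?thesis by (cases "v = s") (simp_all add: w1_def)
      qed
      \<comment> \<open>If \<open>(s, r)\<close> is an arc, it forms a 2-cycle with
        \<open>(r, s)\<close>, whose total weight is below \<open>c\<close>.\<close>
      have "w (s, r) < c"
      proof (cases "(s, r) \<in> A")
        case True
        then have "is_cycle A [r, s]"
          using rs neq unfolding is_cycle_def cycle_arcs_def by simp
        then show ?thesis using cycles[of "[r, s]"] nonneg[of "(r, s)"]
          by (simp add: cycle_arcs_def)
      qed (use zero c in simp)
      then have step: "2 powr (- (d s - w (s, r)) / c) < 2 powr (- d r / c) + 2 powr (- d s / c)"
        using c max[OF r] by (intro powr_merge_less)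
      have "1 \<le> (\<Sum>v\<in>V - {r}. 2 powr (- (if v = s then d s - w (s, r) else d v) / c))"
        using IH by (simp only: outdeg cong: sum.cong)
      also have "\<dots> = 2 powr (- (d s - w (s, r)) / c) + (\<Sum>v\<in>V - {r} - {s}. 2 powr (- d v / c))"
        using s neq fin by (subst sum.remove[of _ s]) auto
      also have "\<dots> < 2 powr (- d r / c) + (2 powr (- d s / c) + (\<Sum>v\<in>V - {r} - {s}. 2 powr (- d v / c)))"
        using step by simp
      also have "\<dots> = (\<Sum>v\<in>V. 2 powr (- d v / c))"
        by (rule sum_split[symmetric])
      finally show ?thesis .
    qed
    then show ?thesis unfolding d_def by simp
  qed
qed

section \<open>Transfer to library cycles and conclusion\<close>

lemma cas_zip_shift:
  "pre_digraph.cas (with_proj D) x (zip (x # ys) (ys @ [z])) z"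
  by (induction ys arbitrary: x) (auto simp: pre_digraph.cas.simps)

lemma awalk_verts_zip_shift:
  "pre_digraph.awalk_verts (with_proj D) x (zip (x # ys) (ys @ [z])) = x # ys @ [z]"
  by (induction ys arbitrary: x) (auto simp: pre_digraph.awalk_verts.simps)

text \<open>The walk from the head \<open>x\<close> of the list visits \<open>x # ys @ [x]\<close>,
  whose tail is distinct, as a library cycle demands. The arcs have distinct tails, so summing over
  their set or their list is the same.\<close>

lemma cycle_of_is_cycle:
  assumes "is_cycle (parcs D) xs" "set xs \<subseteq> pverts D"
  shows "pre_digraph.cycle (with_proj D) (cycle_arcs xs)"
    and "cycle_weight w (cycle_arcs xs) = sum_list (map w (cycle_arcs xs))"
proof -
  obtain x ys where xs: "xs = x # ys"
    using assms(1) unfolding is_cycle_def by (cases xs) auto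
  have dist: "distinct (x # ys)" using assms(1) unfolding is_cycle_def xs by simp
  have arcs: "cycle_arcs xs = zip (x # ys) (ys @ [x])"
    unfolding xs cycle_arcs_def by simp
  have sub: "set (zip (x # ys) (ys @ [x])) \<subseteq> parcs D"
    using assms(1) unfolding is_cycle_def arcs by simp
  have "pre_digraph.awalk (with_proj D) x (cycle_arcs xs) x"
    unfolding pre_digraph.awalk_def arcs using sub assms(2) cas_zip_shift xs by auto
  moreover have "distinct (tl (pre_digraph.awalk_verts (with_proj D) x (cycle_arcs xs)))"
    unfolding arcs awalk_verts_zip_shift using dist by simp
  moreover have "cycle_arcs xs \<noteq> []" unfolding arcs by (cases ys) auto
  ultimately show "pre_digraph.cycle (with_proj D) (cycle_arcs xs)"
    unfolding pre_digraph.cycle_def by blast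
  have "distinct (cycle_arcs xs)"
    unfolding arcs using dist by (rule distinct_zipI1)
  then show "cycle_weight w (cycle_arcs xs) = sum_list (map w (cycle_arcs xs))"
    unfolding cycle_weight_def by (simp add: sum_list_distinct_conv_sum_set)
qed

theorem theorem2:
  fixes D :: "'a pair_pre_digraph" and w :: "('a \<times> 'a) weight_fun" and n :: nat
  assumes "pair_digraph D"
    and "\<And>a. a \<in> parcs D \<Longrightarrow> w a \<ge> 0"
    and "card (pverts D) = n" and "n \<ge> 2"
    and "\<And>v. v \<in> pverts D \<Longrightarrow> weighted_outdegree D w v \<ge> 1"
  shows "\<exists>C. pre_digraph.cycle (with_proj D) C \<and> cycle_weight w C \<ge> 1 / log 2 (real n)"
proof (rule ccontr)
  assume no_cycle: "\<not> ?thesis"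
  interpret pair_digraph D by fact
  \<comment> \<open>Chosen so that \<open>2 powr (- 1 / c) = 1 / n\<close>: outdegrees of at least 1
    then make the \<open>n\<close> summands total at most 1.\<close>
  define c where "c = 1 / log 2 (real n)"
  have c: "0 < c" using assms(4) unfolding c_def by simp
  \<comment> \<open>\<open>w\<close> is arbitrary off the arcs, whereas
    \<open>kraft_inequality\<close> needs it to be 0 there.\<close>
  define w0 where "w0 a = (if a \<in> parcs D then w a else 0)" for a
  have sub: "parcs D \<subseteq> pverts D \<times> pverts D"
    using in_arcsD1 in_arcsD2 by auto
  have cycles: "sum_list (map w0 (cycle_arcs xs)) < c" if cyc: "is_cycle (parcs D) xs" for xs
  proof -
    have "set xs \<subseteq> pverts D"
      using cyc sub unfolding is_cycle_def fst_set_cycle_arcs[of xs, symmetric] by auto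
    then have "sum_list (map w (cycle_arcs xs)) < c"
      using cycle_of_is_cycle[OF cyc] no_cycle unfolding c_def by (metis not_less)
    moreover have "map w0 (cycle_arcs xs) = map w (cycle_arcs xs)"
      using cyc unfolding is_cycle_def w0_def by auto
    ultimately show ?thesis by metis
  qed
  have outdeg: "1 \<le> (\<Sum>u\<in>pverts D. w0 (v, u))" if "v \<in> pverts D" for v
  proof -
    have "weighted_outdegree D w v = (\<Sum>u\<in>pverts D. w0 (v, u))"
      unfolding weighted_outdegree_def out_neighbours_def w0_def
      using sub by (intro sum.mono_neutral_cong_left) auto
    then show ?thesis using assms(5)[OF that] by simp
  qed
  have "1 < (\<Sum>v\<in>pverts D. 2 powr (- (\<Sum>u\<in>pverts D. w0 (v, u)) / c))"
    using kraft_inequality[of "pverts D" "parcs D" w0 c] sub c cycles assms(2-4) no_loops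
    unfolding w0_def by fastforce
  also have "\<dots> \<le> (\<Sum>v\<in>pverts D. 2 powr (- 1 / c))"
    using outdeg c by (intro sum_mono) (simp add: divide_right_mono)
  also have "\<dots> = 1"
    using assms(3,4) unfolding c_def by (simp add: powr_minus)
  finally show False by simp
qed

end
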